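(* Let $p$ be any precise probability tree. For any $f\in\overline{\mathbb{V}}$ and any $s\in\mathscr{X}^*$, we have that $\overline{\mathrm{E}}{}^{1}_{\mathrm{meas},p}(f\vert s)=\overline{\mathrm{E}}_{\mathrm{A},p}(f\vert s)$.
   Context: Conventions: $\mathbb{N}=\{1,2,\dots\}$, $\mathbb{N}_0=\mathbb{N}\cup\{0\}$, $\overline{\mathbb{R}}=\mathbb{R}\cup\{-\infty,+\infty\}$, with $+\infty-\infty=-\infty+\infty=+\infty$ and $0\cdot(+\infty)=0\cdot(-\infty)=0$. Inequalities between functions and limits of functions are pointwise. Setting: $\mathscr{X}$ is a finite non-empty set (state space). A situation is a finite string $x_{1:n}=(x_1,\dots,x_n)\in\mathscr{X}^n$, $n\in\mathbb{N}_0$ (the empty string is denoted $\Box$); $\mathscr{X}^*$ is the set of all situations. $\Omega=\mathscr{X}^{\mathbb{N}}$ is the set of paths $\omega=\omega_1\omega_2\cdots$, and $\omega^n=(\omega_1,\dots,\omega_n)$. For $s=x_{1:n}$, $\Gamma(s)=\{\omega\in\Omega:\omega^n=x_{1:n}\}$ (cylinder event) and $\mathbb{I}_s$ is the indicator of $\Gamma(s)$. $\overline{\mathbb{V}}$ is the set of all maps $\Omega\to\overline{\mathbb{R}}$ (global variables) and $\overline{\mathbb{V}}_{\mathrm b}$ the set of those that are bounded below by a real. A gamble is a bounded real-valued function. $f\in\overline{\mathbb{V}}$ is $n$-measurable if $f(\omega)$ depends only on $\omega^n$; it is finitary if it is $n$-measurable for some $n\in\mathbb{N}_0$. $\mathbb{V}_{\mathrm{fin}}$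 is the set of finitary gambles on $\Omega$. A sequence $\{f_n\}$ is uniformly bounded below if there is a real $c$ with $f_n\geq c$ for all $n$. $\mathscr{L}(\mathscr{X})$ is the set of all real-valued functions on $\mathscr{X}$; for $f\in\mathscr{L}(\mathscr{X})$, $f(X_{n+1})$ is the global variable $\omega\mapsto f(\omega_{n+1})$. Precise probability tree and measures: a precise probability tree $p$ assigns to each $s\in\mathscr{X}^*$ a probability mass function $p(\cdot\vert s)$ on $\mathscr{X}$. Let $\mathscr{F}$ be the $\sigma$-algebra on $\Omega$ generated by all cylinder events. For each $x_{1:n}\in\mathscr{X}^*$, $\mathrm{P}(\cdot\vert x_{1:n})$ is the unique $\sigma$-additive probability measure on $\mathscr{F}$ such that, for all $z_{1:m}\in\mathscr{X}^*$, $\mathrm{P}(\Gamma(z_{1:m})\vert x_{1:n})$ equals $\prod_{i=n}^{m-1}p(z_{i+1}\vert z_{1:i})$ if $n<m$ and $z_{1:n}=x_{1:n}$; $1$ if $n\geq m$ and $z_{1:m}=x_{1:m}$; and $0$ otherwise. For $\mathscr{F}$-measurable $f\in\overline{\mathbb{V}}$, $\mathrm{E}_{\mathrm{meas},p}(f\vert s)$ is the Lebesgue integral $\int_\Omega f\,\mathrm{d}\mathrm{P}(\cdot\vert s)=\int f^+\,\mathrm{d}\mathrm{P}(\cdot\vert s)-\int f^-\,\mathrm{d}\mathrm{P}(\cdot\vert s)$, which exists iff at least one of these two integrals is finite; it always exists for $\mathscr{F}$-measurable $f\in\overline{\mathbb{V}}_{\mathrm b}$. For all $f\in\overline{\mathbb{V}}$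 and $s\in\mathscr{X}^*$, $$\overline{\mathrm{E}}{}^{1}_{\mathrm{meas},p}(f\vert s)=\inf\{\mathrm{E}_{\mathrm{meas},p}(g\vert s):g\in\overline{\mathbb{V}}_{\mathrm b},\ g\text{ is }\mathscr{F}\text{-measurable and }g\geq f\}.$$ Axiomatic model: a global upper expectation is any map $\overline{\mathrm{E}}:\overline{\mathbb{V}}\times\mathscr{X}^*\to\overline{\mathbb{R}}$, $(f,s)\mapsto\overline{\mathrm{E}}(f\vert s)$; $\overline{\mathrm{E}}(f\vert X_{1:n})$ denotes the global variable $\omega\mapsto\overline{\mathrm{E}}(f\vert\omega^n)$. With $\overline{\mathrm{Q}}_s(f)=\sum_{x\in\mathscr{X}}f(x)p(x\vert s)$ for $f\in\mathscr{L}(\mathscr{X})$, the axioms are: P1: $\overline{\mathrm{E}}(f(X_{n+1})\vert x_{1:n})=\overline{\mathrm{Q}}_{x_{1:n}}(f)$ for all $f\in\mathscr{L}(\mathscr{X})$, $x_{1:n}\in\mathscr{X}^*$. P2: $\overline{\mathrm{E}}(f\vert s)=\overline{\mathrm{E}}(f\,\mathbb{I}_s\vert s)$ for all $f\in\mathbb{V}_{\mathrm{fin}}$, $s\in\mathscr{X}^*$. P3: $\overline{\mathrm{E}}(f\vert X_{1:n})\leq\overline{\mathrm{E}}(\overline{\mathrm{E}}(f\vert X_{1:n+1})\vert X_{1:n})$ for all $f\in\mathbb{V}_{\mathrm{fin}}$, $n\in\mathbb{N}_0$. P4: $f\leq g\Rightarrow\overline{\mathrm{E}}(f\vert s)\leq\overline{\mathrm{E}}(g\vert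 s)$ for all $f,g\in\overline{\mathbb{V}}$, $s\in\mathscr{X}^*$. P5: for any sequence $\{f_n\}_{n\in\mathbb{N}_0}$ of finitary gambles that is uniformly bounded below and any $s\in\mathscr{X}^*$, if $\lim_{n}f_n=f$ pointwise then $\limsup_{n}\overline{\mathrm{E}}(f_n\vert s)\geq\overline{\mathrm{E}}(f\vert s)$. $\overline{\mathrm{E}}_{\mathrm{A},p}$ is the most conservative, i.e. pointwise largest, global upper expectation satisfying P1–P5 (it exists). *)

theory Defs
  imports "HOL-Probability.Probability"
begin

(* The state space is a type of class finite. Paths are indexed from 0, so the
   k-th state of a path w (counted from 1) is w (k - 1); the state following a
   situation s along a path w through s is w (length s). *)

type_synonym 'x path = "nat \<Rightarrow> 'x"
type_synonym 'x situation = "'x list"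
type_synonym 'x global_var = "'x path \<Rightarrow> ereal"
type_synonym 'x prob_tree = "'x situation \<Rightarrow> 'x pmf"
type_synonym 'x global_exp = "'x global_var \<Rightarrow> 'x situation \<Rightarrow> ereal"

definition path_prefix :: "'x path \<Rightarrow> nat \<Rightarrow> 'x situation" where
  "path_prefix \<omega> n = map \<omega> [0..<n]"

definition cylinder :: "'x situation \<Rightarrow> 'x path set" where
  "cylinder s = {\<omega>. path_prefix \<omega> (length s) = s}"

definition bounded_below :: "'x global_var \<Rightarrow> bool" where
  "bounded_below f \<longleftrightarrow> (\<exists>c::real. \<forall>\<omega>. ereal c \<le> f \<omega>)"

definition gamble :: "'x global_var \<Rightarrow> bool" where
  "gamble f \<longleftrightarrow> (\<exists>c::real. \<forall>\<omega>. \<bar>f \<omega>\<bar> \<le> ereal c)"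

definition n_measurable :: "nat \<Rightarrow> 'x global_var \<Rightarrow> bool" where
  "n_measurable n f \<longleftrightarrow> (\<forall>\<omega> \<omega>'. path_prefix \<omega> n = path_prefix \<omega>' n \<longrightarrow> f \<omega> = f \<omega>')"

definition finitary :: "'x global_var \<Rightarrow> bool" where
  "finitary f \<longleftrightarrow> (\<exists>n. n_measurable n f)"

definition finitary_gambles :: "'x global_var set" where
  "finitary_gambles = {f. finitary f \<and> gamble f}"


definition path_algebra :: "'x path measure" where
  "path_algebra = sigma UNIV (range cylinder)"

definition cylinder_prob :: "'x prob_tree \<Rightarrow> 'x situation \<Rightarrow> 'x situation \<Rightarrow> real" where
  "cylinder_prob p s z =
    (if length s < length z \<and> take (length s) z = s
       then \<Prod>i = length s..<length z. pmf (p (take i z)) (z ! i)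
     else if length z \<le> length s \<and> take (length z) s = z then 1
     else 0)"

definition path_measure :: "'x prob_tree \<Rightarrow> 'x situation \<Rightarrow> 'x path measure" where
  "path_measure p s =
    (THE M. prob_space M \<and> sets M = sets path_algebra \<and>
       (\<forall>z. measure M (cylinder z) = cylinder_prob p s z))"

(* If both integrals are infinite, the value is PInfty; this is harmless because
   E_meas is only used for bounded below variables. *)
definition E_meas :: "'x prob_tree \<Rightarrow> 'x global_exp" where
  "E_meas p f s =
     enn2ereal (\<integral>\<^sup>+ \<omega>. e2ennreal (max 0 (f \<omega>)) \<partial>path_measure p s)
     - enn2ereal (\<integral>\<^sup>+ \<omega>. e2ennreal (max 0 (- f \<omega>)) \<partial>path_measure p s)"

definition upper_E_meas :: "'x prob_tree \<Rightarrow> 'x global_exp" where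
  "upper_E_meas p f s =
     (INF g \<in> {g. bounded_below g \<and> g \<in> borel_measurable path_algebra \<and> f \<le> g}. E_meas p g s)"


definition local_exp :: "'x::finite prob_tree \<Rightarrow> 'x situation \<Rightarrow> ('x \<Rightarrow> real) \<Rightarrow> real" where
  "local_exp p s f = (\<Sum>x\<in>UNIV. f x * pmf (p s) x)"

definition P1 :: "'x::finite prob_tree \<Rightarrow> 'x global_exp \<Rightarrow> bool" where
  "P1 p E \<longleftrightarrow> (\<forall>f s. E (\<lambda>\<omega>. ereal (f (\<omega> (length s)))) s = ereal (local_exp p s f))"

definition P2 :: "'x global_exp \<Rightarrow> bool" where
  "P2 E \<longleftrightarrow> (\<forall>f\<in>finitary_gambles. \<forall>s. E f s = E (\<lambda>\<omega>. f \<omega> * indicator (cylinder s) \<omega>) s)"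

definition P3 :: "'x global_exp \<Rightarrow> bool" where
  "P3 E \<longleftrightarrow> (\<forall>f\<in>finitary_gambles. \<forall>n \<omega>.
     E f (path_prefix \<omega> n) \<le> E (\<lambda>\<omega>'. E f (path_prefix \<omega>' (n + 1))) (path_prefix \<omega> n))"

definition P4 :: "'x global_exp \<Rightarrow> bool" where
  "P4 E \<longleftrightarrow> (\<forall>f g s. f \<le> g \<longrightarrow> E f s \<le> E g s)"

definition P5 :: "'x global_exp \<Rightarrow> bool" where
  "P5 E \<longleftrightarrow> (\<forall>(F :: nat \<Rightarrow> 'x global_var) f s.
     (\<forall>n. F n \<in> finitary_gambles) \<longrightarrow>
     (\<exists>c::real. \<forall>n \<omega>. ereal c \<le> F n \<omega>) \<longrightarrow>
     (\<forall>\<omega>. (\<lambda>n. F n \<omega>) \<longlonglongrightarrow> f \<omega>) \<longrightarrow>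
     limsup (\<lambda>n. E (F n) s) \<ge> E f s)"

(* The order on global upper expectations is the pointwise one. *)
definition upper_E_ax :: "'x::finite prob_tree \<Rightarrow> 'x global_exp" where
  "upper_E_ax p = (GREATEST E. P1 p E \<and> P2 E \<and> P3 E \<and> P4 E \<and> P5 E)"

end

theory Submission
  imports Defs
begin

text \<open>The proof shows that the measure-theoretic upper expectation satisfies P1--P5 and that it
  dominates every global upper expectation that does; the largest such expectation is then the
  measure-theoretic one. In particular, the existence of a largest one comes out of the proof.

  For the first part, on finitary gambles the upper expectation is an ordinary integral. P1, P2 and P3
  then say that the path measure of a situation lives on the cylinder of that situation and is the
  mixture, with the weights of the tree, of the path measures of its successors
  (\<open>integral_tree_step\<close>). P4 is clear. P5 is Fatou's lemma (\<open>E_meas_Fatou\<close>): the limit is itself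
  measurable and bounded below, so that its upper expectation is again an integral.

  For the second part, P1--P4 bound \<open>E\<close> on finitary gambles by the integral, by backward induction
  along the tree (\<open>axioms_le_integral\<close>). By P5 the bound passes to limits of increasing sequences of
  finitary gambles. Every bounded below measurable variable \<open>g\<close> with finite integral lies below such a
  limit whose integral is larger by an arbitrarily small amount
  (\<open>finitary_approximation_from_above\<close>). This rests on outer regularity: a measurable set of paths is
  contained in an open set, that is, a union of cylinders, of almost the same probability. By P4,
  \<open>E\<close> is at most the integral of \<open>g\<close> for every admissible \<open>g\<close> above the variable in question, hence at
  most the infimum.

  All of this presupposes that the path measures exist. They are obtained as images of a product
  measure that chooses a successor for every situation independently (\<open>tree_measure\<close>).\<close>

section \<open>Prefixes, cylinders and open sets of paths\<close>

lemma length_path_prefix [simp]: "length (path_prefix \<omega> n) = n"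
  by (simp add: path_prefix_def)

lemma path_prefix_Suc: "path_prefix \<omega> (Suc n) = path_prefix \<omega> n @ [\<omega> n]"
  by (simp add: path_prefix_def)

lemma nth_path_prefix [simp]: "i < n \<Longrightarrow> path_prefix \<omega> n ! i = \<omega> i"
  by (simp add: path_prefix_def)

lemma take_path_prefix: "m \<le> n \<Longrightarrow> take m (path_prefix \<omega> n) = path_prefix \<omega> m"
  by (simp add: path_prefix_def take_map take_upt)

lemma path_prefix_eq_mono:
  "path_prefix \<omega> n = path_prefix \<omega>' n \<Longrightarrow> m \<le> n \<Longrightarrow> path_prefix \<omega> m = path_prefix \<omega>' m"
  by (metis take_path_prefix)

lemma mem_cylinder_iff: "\<omega> \<in> cylinder s \<longleftrightarrow> path_prefix \<omega> (length s) = s"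
  by (simp add: cylinder_def)

lemma path_prefix_mem_cylinder [simp]: "\<omega> \<in> cylinder (path_prefix \<omega> n)"
  by (simp add: cylinder_def)

lemma cylinder_path_prefix_antimono:
  "m \<le> n \<Longrightarrow> cylinder (path_prefix \<omega> n) \<subseteq> cylinder (path_prefix \<omega> m)"
  unfolding mem_cylinder_iff subset_iff length_path_prefix by (intro allI impI) (rule path_prefix_eq_mono)

definition some_path :: "'x situation \<Rightarrow> 'x path" where
  "some_path s = (\<lambda>i. if i < length s then s ! i else undefined)"

lemma path_prefix_some_path [simp]: "path_prefix (some_path s) (length s) = s"
  by (rule nth_equalityI) (simp_all add: some_path_def)

lemma cylinder_Int_cases:
  "cylinder a \<inter> cylinder b = cylinder b \<or> cylinder a \<inter> cylinder b = cylinder a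
    \<or> cylinder a \<inter> cylinder b = {}"
proof -
  have aux: "cylinder a \<inter> cylinder b = cylinder b \<or> cylinder a \<inter> cylinder b = {}"
    if "length a \<le> length b" for a b :: "'a list"
  proof -
    have "\<omega> \<in> cylinder a \<longleftrightarrow> take (length a) b = a" if "\<omega> \<in> cylinder b" for \<omega>
      using take_path_prefix[OF \<open>length a \<le> length b\<close>, of \<omega>] that by (simp add: mem_cylinder_iff)
    then show ?thesis by blast
  qed
  show ?thesis
  proof (cases "length a \<le> length b")
    case True
    then show ?thesis using aux[of a b] by blast
  next
    case False
    then show ?thesis using aux[of b a] by (simp add: Int_commute)
  qed
qed

text \<open>These are the open sets of the product of the discrete topologies on the state space; the
  predicate is stated directly so that the state space needs no topology.\<close>

definition prefix_open :: "'x path set \<Rightarrow> bool" where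
  "prefix_open U \<longleftrightarrow> (\<forall>\<omega>\<in>U. \<exists>n. cylinder (path_prefix \<omega> n) \<subseteq> U)"

lemma prefix_open_Union: "(\<And>i. i \<in> I \<Longrightarrow> prefix_open (U i)) \<Longrightarrow> prefix_open (\<Union>i\<in>I. U i)"
  unfolding prefix_open_def by (meson UN_E UN_upper subset_trans)

lemma prefix_open_Int:
  assumes "prefix_open U" "prefix_open V"
  shows "prefix_open (U \<inter> V)"
  unfolding prefix_open_def
proof
  fix \<omega> assume "\<omega> \<in> U \<inter> V"
  then obtain m n where "cylinder (path_prefix \<omega> m) \<subseteq> U" "cylinder (path_prefix \<omega> n) \<subseteq> V"
    using assms unfolding prefix_open_def by blast
  then have "cylinder (path_prefix \<omega> (max m n)) \<subseteq> U \<inter> V"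
    using cylinder_path_prefix_antimono[of m "max m n" \<omega>]
      cylinder_path_prefix_antimono[of n "max m n" \<omega>] by auto
  then show "\<exists>n. cylinder (path_prefix \<omega> n) \<subseteq> U \<inter> V" ..
qed

lemma prefix_open_INT:
  fixes V :: "nat \<Rightarrow> 'x path set"
  assumes "\<And>i. prefix_open (V i)"
  shows "prefix_open (\<Inter>i<n. V i)"
proof (induction n)
  case 0
  show ?case by (simp add: prefix_open_def)
next
  case (Suc n)
  then show ?case
    using prefix_open_Int[OF assms[of n] Suc] by (simp add: lessThan_Suc)
qed

lemma space_path_algebra [simp]: "space path_algebra = UNIV"
  by (simp add: path_algebra_def)

lemma sets_path_algebra: "sets path_algebra = sigma_sets UNIV (range cylinder)"
  by (simp add: path_algebra_def)

lemma cylinder_sets [measurable]: "cylinder s \<in> sets path_algebra"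
  by (auto simp: sets_path_algebra)

lemma prefix_open_sets:
  fixes U :: "'x::finite path set"
  assumes "prefix_open U"
  shows "U \<in> sets path_algebra"
proof -
  have "U = (\<Union>s\<in>{s. cylinder s \<subseteq> U}. cylinder s)"
    using assms unfolding prefix_open_def by (auto, metis path_prefix_mem_cylinder)
  also have "\<dots> \<in> sets path_algebra"
    by (rule sets.countable_UN') auto
  finally show ?thesis .
qed

section \<open>Outer regularity\<close>

text \<open>The witness for a countable union of sets is the union of the outer open sets together with a
  \<^emph>\<open>finite\<close> intersection of the open neighbourhoods of the complements, because only finite
  intersections stay open. What is lost by cutting the intersection off is a decreasing sequence of
  sets with empty intersection. Asking for open neighbourhoods of both the set and its complement
  makes the property invariant under complementation.\<close>

lemma open_approximation:
  fixes M :: "'x::finite path measure"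
  assumes "finite_measure M" and sets_M: "sets M = sets path_algebra"
    and "A \<in> sets path_algebra"
  shows "\<forall>e>0. \<exists>U V. prefix_open U \<and> prefix_open V \<and> A \<subseteq> U \<and> - A \<subseteq> V \<and> measure M (U \<inter> V) < e"
proof -
  interpret finite_measure M by fact
  have om: "prefix_open U \<Longrightarrow> U \<in> sets M" for U
    by (simp add: sets_M prefix_open_sets)
  from assms(3)[unfolded sets_path_algebra] show ?thesis
  proof (induction rule: sigma_sets.induct)
    case (Basic A)
    then obtain s where A: "A = cylinder s" by auto
    have "prefix_open A"
      unfolding prefix_open_def A by (metis mem_cylinder_iff subset_refl)
    moreover have "prefix_open (- A)"
      unfolding prefix_open_def A
      by (metis (no_types, lifting) ComplD ComplI length_path_prefix mem_cylinder_iff subsetI)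
    ultimately show ?case
      by (metis Compl_disjoint measure_empty order_refl)
  next
    case Empty
    have "prefix_open {}" "prefix_open UNIV" by (auto simp: prefix_open_def)
    then show ?case
      by (metis Int_UNIV_right empty_subsetI measure_empty top_greatest)
  next
    case (Compl A)
    show ?case
    proof (intro allI impI)
      fix e :: real assume "0 < e"
      with Compl obtain U V where "prefix_open U" "prefix_open V" "A \<subseteq> U" "- A \<subseteq> V"
        "measure M (U \<inter> V) < e" by blast
      then show "\<exists>U V. prefix_open U \<and> prefix_open V \<and> UNIV - A \<subseteq> U \<and> - (UNIV - A) \<subseteq> V
          \<and> measure M (U \<inter> V) < e"
        by (intro exI[of _ V] exI[of _ U]) (auto simp: Int_commute)
    qed
  next
    case (Union A)
    show ?case
    proof (intro allI impI)
      fix e :: real assume e: "0 < e"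
      \<comment> \<open>Half of the error goes to the countably many approximations, half to the cut-off.\<close>
      define d where "d i = e / 2 * (1/2) ^ Suc i" for i :: nat
      have dpos: "0 < d i" for i using e by (simp add: d_def)
      have "\<forall>i. \<exists>U V. prefix_open U \<and> prefix_open V \<and> A i \<subseteq> U \<and> - A i \<subseteq> V \<and> measure M (U \<inter> V) < d i"
        using Union dpos by blast
      then obtain U V where UV: "\<And>i. prefix_open (U i)" "\<And>i. prefix_open (V i)"
        "\<And>i. A i \<subseteq> U i" "\<And>i. - A i \<subseteq> V i" "\<And>i. measure M (U i \<inter> V i) < d i"
        by metis
      define UU where "UU = (\<Union>i. U i)"
      define VV where "VV n = (\<Inter>i<n. V i)" for n
      define W where "W = (\<Union>i. U i \<inter> V i)"
      have oUU: "prefix_open UU" unfolding UU_def using UV(1) by (rule prefix_open_Union)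
      have oVV: "prefix_open (VV n)" for n unfolding VV_def using UV(2) by (rule prefix_open_INT)
      have oW: "prefix_open W"
        unfolding W_def using UV(1,2) by (intro prefix_open_Union prefix_open_Int)
      have dsum: "d sums (e / 2)"
        unfolding d_def using sums_mult[OF power_half_series, of "e / 2"] by simp
      have "measure M W \<le> (\<Sum>i. measure M (U i \<inter> V i))"
        unfolding W_def
      proof (rule finite_measure_subadditive_countably)
        show "range (\<lambda>i. U i \<inter> V i) \<subseteq> sets M"
          using UV(1,2) om by auto
        show "summable (\<lambda>i. measure M (U i \<inter> V i))"
          by (rule summable_comparison_test'[where g=d and N=0])
            (use dsum UV(5) in \<open>auto simp: sums_iff less_imp_le\<close>)
      qed
      also have "\<dots> \<le> (\<Sum>i. d i)"
      proof (rule suminf_le)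
        show "summable (\<lambda>i. measure M (U i \<inter> V i))"
          by (rule summable_comparison_test'[where g=d and N=0])
            (use dsum UV(5) in \<open>auto simp: sums_iff less_imp_le\<close>)
      qed (use dsum UV(5) in \<open>auto simp: sums_iff less_imp_le\<close>)
      finally have W: "measure M W \<le> e / 2" using dsum by (simp add: sums_iff)
      define D where "D n = (UU \<inter> VV n) - W" for n
      have Dsets: "D n \<in> sets M" for n
        unfolding D_def using om oUU oVV oW by auto
      have "(\<lambda>n. measure M (D n)) \<longlonglongrightarrow> measure M (\<Inter>n. D n)"
      proof (rule finite_Lim_measure_decseq)
        show "range D \<subseteq> sets M" using Dsets by auto
        show "decseq D" unfolding decseq_def D_def VV_def by auto
      qed
      \<comment> \<open>A path in all \<open>D n\<close> lies in some \<open>U i\<close> and in every \<open>V j\<close>, hence in \<open>W\<close>.\<close>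
      moreover have "(\<Inter>n. D n) = {}"
        unfolding D_def UU_def VV_def W_def by auto
      ultimately have "(\<lambda>n. measure M (D n)) \<longlonglongrightarrow> 0" by simp
      then have "eventually (\<lambda>n. measure M (D n) < e / 2) sequentially"
        using e by (intro order_tendstoD(2)) auto
      then obtain n where n: "measure M (D n) < e / 2"
        by (auto simp: eventually_sequentially)
      have "measure M (UU \<inter> VV n) \<le> measure M (W \<union> D n)"
        using om[OF oW] Dsets[of n] by (intro finite_measure_mono sets.Un) (auto simp: D_def)
      also have "\<dots> \<le> measure M W + measure M (D n)"
        using om[OF oW] Dsets by (intro measure_Un_le)
      also have "\<dots> < e" using W n by simp
      finally have "measure M (UU \<inter> VV n) < e" .
      moreover have "(\<Union>i. A i) \<subseteq> UU" "- (\<Union>i. A i) \<subseteq> VV n"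
        unfolding UU_def VV_def using UV(3,4) by (blast, blast)
      ultimately show "\<exists>U V. prefix_open U \<and> prefix_open V \<and> \<Union> (range A) \<subseteq> U
          \<and> - \<Union> (range A) \<subseteq> V \<and> measure M (U \<inter> V) < e"
        using oUU oVV by blast
    qed
  qed
qed

lemma outer_regular_path_measure:
  fixes M :: "'x::finite path measure"
  assumes "finite_measure M" and sets_M: "sets M = sets path_algebra"
    and A: "A \<in> sets path_algebra" and "0 < e"
  obtains U where "prefix_open U" "A \<subseteq> U" "measure M U \<le> measure M A + e"
proof -
  interpret finite_measure M by fact
  obtain U V where UV: "prefix_open U" "prefix_open V" "A \<subseteq> U" "- A \<subseteq> V" "measure M (U \<inter> V) < e"
    using open_approximation[OF assms(1-3)] \<open>0 < e\<close> by blast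
  have m: "U \<in> sets M" "V \<in> sets M" "A \<in> sets M"
    using UV A by (auto simp: sets_M prefix_open_sets)
  have "measure M U \<le> measure M (A \<union> (U \<inter> V))"
    using m UV by (intro finite_measure_mono) auto
  also have "\<dots> \<le> measure M A + measure M (U \<inter> V)"
    using m by (intro measure_Un_le) auto
  finally show ?thesis using that[of U] UV by auto
qed

section \<open>The path measure\<close>

text \<open>To construct the path measure of \<open>s\<close>, draw independently for every situation \<open>t\<close> a state \<open>y t\<close>
  with law \<open>p t\<close>, and let the path follow \<open>s\<close> first and afterwards, at each situation \<open>t\<close> that it
  reaches, move to \<open>y t\<close>. The situations that a path visits are distinct, because their lengths differ;
  the probability of a cylinder is therefore a product.\<close>

fun driven_prefix :: "'x situation \<Rightarrow> ('x situation \<Rightarrow> 'x) \<Rightarrow> nat \<Rightarrow> 'x situation" where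
  "driven_prefix s y 0 = []"
| "driven_prefix s y (Suc n) =
    driven_prefix s y n @ [if n < length s then s ! n else y (driven_prefix s y n)]"

definition driven_path :: "'x situation \<Rightarrow> ('x situation \<Rightarrow> 'x) \<Rightarrow> 'x path" where
  "driven_path s y n = (if n < length s then s ! n else y (driven_prefix s y n))"

lemma path_prefix_driven_path: "path_prefix (driven_path s y) n = driven_prefix s y n"
  by (induction n) (simp_all add: path_prefix_Suc driven_path_def, simp add: path_prefix_def)

lemma driven_path_mem_cylinder_iff:
  "driven_path s y \<in> cylinder z \<longleftrightarrow>
    take (length z) s = take (length s) z \<and> (\<forall>i\<in>{length s..<length z}. y (take i z) = z ! i)"
proof (induction z rule: rev_induct)
  case Nil
  show ?case by (simp add: mem_cylinder_iff path_prefix_def)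
next
  case (snoc x z)
  have "driven_path s y \<in> cylinder (z @ [x]) \<longleftrightarrow>
      driven_path s y \<in> cylinder z \<and> (if length z < length s then s ! length z else y z) = x"
    by (auto simp: mem_cylinder_iff path_prefix_driven_path)
  also have "\<dots> \<longleftrightarrow> take (length (z @ [x])) s = take (length s) (z @ [x]) \<and>
      (\<forall>i\<in>{length s..<length (z @ [x])}. y (take i (z @ [x])) = (z @ [x]) ! i)"
  proof (cases "length z < length s")
    case True
    then show ?thesis
      unfolding snoc by (auto simp: take_Suc_conv_app_nth)
  next
    case False
    then have "{length s..<length (z @ [x])} = insert (length z) {length s..<length z}" by auto
    moreover have "(\<forall>i\<in>{length s..<length z}. y (take i (z @ [x])) = (z @ [x]) ! i) \<longleftrightarrow>
        (\<forall>i\<in>{length s..<length z}. y (take i z) = z ! i)"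
      by (auto simp: nth_append)
    ultimately show ?thesis
      unfolding snoc using False by auto
  qed
  finally show ?case .
qed

definition tree_measure :: "'x prob_tree \<Rightarrow> 'x situation \<Rightarrow> 'x path measure" where
  "tree_measure p s =
    distr (\<Pi>\<^sub>M t\<in>UNIV. measure_pmf (p t)) path_algebra (driven_path s)"

lemma tree_measure:
  fixes p :: "'x::finite prob_tree"
  shows "prob_space (tree_measure p s)"
    and "measure (tree_measure p s) (cylinder z) = cylinder_prob p s z"
proof -
  let ?P = "\<Pi>\<^sub>M t\<in>UNIV. measure_pmf (p t)"
  interpret product_prob_space "\<lambda>t. measure_pmf (p t)" UNIV
    by (intro product_prob_spaceI prob_space_measure_pmf)
  define J where "J z = (\<lambda>i. take i z) ` {length s..<length z}" for z :: "'x list"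
  have pre: "driven_path s -` cylinder z =
      (if take (length z) s = take (length s) z
       then prod_emb UNIV (\<lambda>t. measure_pmf (p t)) (J z) (\<Pi>\<^sub>E t\<in>J z. {z ! length t}) else {})" for z
    by (auto simp: driven_path_mem_cylinder_iff prod_emb_def J_def space_PiM PiE_iff)
  have finJ: "finite (J z)" for z by (simp add: J_def)
  have emb: "prod_emb UNIV (\<lambda>t. measure_pmf (p t)) (J z) (\<Pi>\<^sub>E t\<in>J z. {z ! length t}) \<in> sets ?P" for z
    using finJ by (intro sets_PiM_I) auto
  have meas: "driven_path s \<in> measurable ?P path_algebra"
    unfolding path_algebra_def
  proof (rule measurable_measure_of)
    fix A assume "A \<in> range (cylinder :: 'x list \<Rightarrow> _)"
    then show "driven_path s -` A \<inter> space ?P \<in> sets ?P"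
      using emb by (auto simp: pre space_PiM)
  qed (auto simp: space_PiM)
  show "prob_space (tree_measure p s)"
    unfolding tree_measure_def using meas by (rule prob_space_distr)
  have inj: "inj_on (\<lambda>i. take i z) {length s..<length z}"
    by (rule inj_onI) (metis atLeastLessThan_iff length_take min.absorb4)
  have "measure (tree_measure p s) (cylinder z) = measure ?P (driven_path s -` cylinder z)"
    unfolding tree_measure_def using meas by (subst measure_distr) (auto simp: space_PiM)
  also have "\<dots> = (if take (length z) s = take (length s) z then
      (\<Prod>i=length s..<length z. pmf (p (take i z)) (z ! i)) else 0)"
  proof -
    have "measure ?P (prod_emb UNIV (\<lambda>t. measure_pmf (p t)) (J z) (\<Pi>\<^sub>E t\<in>J z. {z ! length t}))
        = (\<Prod>t\<in>J z. measure (measure_pmf (p t)) {z ! length t})"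
      using finJ by (intro measure_PiM_emb) auto
    also have "\<dots> = (\<Prod>i=length s..<length z. pmf (p (take i z)) (z ! i))"
      unfolding J_def using inj by (subst prod.reindex) (auto simp: measure_pmf_single intro!: prod.cong)
    finally show ?thesis unfolding pre by auto
  qed
  also have "\<dots> = cylinder_prob p s z"
    unfolding cylinder_prob_def by auto
  finally show "measure (tree_measure p s) (cylinder z) = cylinder_prob p s z" .
qed

text \<open>Two cylinders are nested or disjoint, so cylinders together with the empty set form a generator
  that is closed under intersection.\<close>

lemma path_measure_unique:
  fixes M N :: "'x path measure"
  assumes "prob_space M" "prob_space N"
    and M: "sets M = sets path_algebra" and N: "sets N = sets path_algebra"
    and eq: "\<And>z. measure M (cylinder z) = measure N (cylinder z)"
  shows "M = N"
proof -
  interpret M: prob_space M by fact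
  interpret N: prob_space N by fact
  show ?thesis
  proof (rule measure_eqI_generator_eq[where E = "insert {} (range cylinder)" and \<Omega> = UNIV
        and A = "\<lambda>_. cylinder []"])
    show "Int_stable (insert {} (range cylinder :: 'x path set set))"
      unfolding Int_stable_def using cylinder_Int_cases by (smt (verit) Int_commute Int_empty_left
        image_iff insert_iff rangeI)
    show "emeasure M X = emeasure N X" if "X \<in> insert {} (range cylinder)" for X
      using that eq by (auto simp: M.emeasure_eq_measure N.emeasure_eq_measure)
    have "sigma_sets UNIV (insert {} (range cylinder)) = sigma_sets UNIV (range cylinder :: 'x path set set)"
      by (rule sigma_sets_eqI) (auto intro: sigma_sets.Empty)
    then show "sets M = sigma_sets UNIV (insert {} (range cylinder))"
      "sets N = sigma_sets UNIV (insert {} (range cylinder))"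
      using M N by (simp_all add: sets_path_algebra)
    show "(\<Union>i. cylinder []) = (UNIV :: 'x path set)"
      by (auto simp: mem_cylinder_iff path_prefix_def)
  qed (use M in auto)
qed

lemma path_measure:
  fixes p :: "'x::finite prob_tree"
  shows prob_space_path_measure: "prob_space (path_measure p s)"
    and sets_path_measure [measurable_cong]: "sets (path_measure p s) = sets path_algebra"
    and measure_path_measure_cylinder: "measure (path_measure p s) (cylinder z) = cylinder_prob p s z"
proof -
  let ?P = "\<lambda>M. prob_space M \<and> sets M = sets path_algebra \<and>
       (\<forall>z. measure M (cylinder z) = cylinder_prob p s z)"
  have "?P (path_measure p s)"
    unfolding path_measure_def
  proof (rule theI)
    show "?P (tree_measure p s)"
      using tree_measure[of p s] by (auto simp: tree_measure_def)
    show "M = tree_measure p s" if "?P M" for M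
      using that tree_measure[of p s] by (intro path_measure_unique) (auto simp: tree_measure_def)
  qed
  then show "prob_space (path_measure p s)" "sets (path_measure p s) = sets path_algebra"
    "measure (path_measure p s) (cylinder z) = cylinder_prob p s z" by auto
qed

lemma space_path_measure [simp]:
  fixes p :: "'x::finite prob_tree"
  shows "space (path_measure p s) = UNIV"
  using sets_eq_imp_space_eq[OF sets_path_measure[of p s]] by simp

section \<open>Expectations of finitary gambles\<close>

definition depends_on_prefix :: "nat \<Rightarrow> ('x path \<Rightarrow> real) \<Rightarrow> bool" where
  "depends_on_prefix n r \<longleftrightarrow> (\<forall>\<omega> \<omega>'. path_prefix \<omega> n = path_prefix \<omega>' n \<longrightarrow> r \<omega> = r \<omega>')"

lemma depends_on_prefixD:
  "depends_on_prefix n r \<Longrightarrow> path_prefix \<omega> n = path_prefix \<omega>' n \<Longrightarrow> r \<omega> = r \<omega>'"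
  unfolding depends_on_prefix_def by blast

lemma depends_on_prefix_const: "depends_on_prefix n (\<lambda>_. c)"
  by (simp add: depends_on_prefix_def)

lemma depends_on_prefix_compose: "depends_on_prefix n (\<lambda>\<omega>. h (path_prefix \<omega> n))"
  unfolding depends_on_prefix_def by presburger

lemma depends_on_prefix_state: "depends_on_prefix (Suc n) (\<lambda>\<omega>. h (\<omega> n))"
  by (simp add: depends_on_prefix_def path_prefix_Suc)

lemma depends_on_prefix_times_cylinder:
  assumes "depends_on_prefix n r"
  shows "depends_on_prefix (max n (length s)) (\<lambda>\<omega>. r \<omega> * indicator (cylinder s) \<omega>)"
  unfolding depends_on_prefix_def
proof (intro allI impI)
  fix \<omega> \<omega>' :: "'a path"
  assume *: "path_prefix \<omega> (max n (length s)) = path_prefix \<omega>' (max n (length s))"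
  have "r \<omega> = r \<omega>'"
    using path_prefix_eq_mono[OF *] assms by (intro depends_on_prefixD) auto
  moreover have "path_prefix \<omega> (length s) = path_prefix \<omega>' (length s)"
    using path_prefix_eq_mono[OF *] by auto
  ultimately show "r \<omega> * indicator (cylinder s) \<omega> = r \<omega>' * indicator (cylinder s) \<omega>'"
    by (auto simp: indicator_def mem_cylinder_iff)
qed

lemma finite_words: "finite {z :: 'x::finite list. length z = n}"
  using finite_lists_length_eq[of "UNIV :: 'x set" n] by simp

lemma depends_on_prefix_expand:
  fixes r :: "'x::finite path \<Rightarrow> real"
  assumes "depends_on_prefix n r"
  shows "r \<omega> = (\<Sum>z | length z = n. r (some_path z) * indicator (cylinder z) \<omega>)"
proof -
  have "(\<Sum>z | length z = n. r (some_path z) * indicator (cylinder z) \<omega>)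
      = (\<Sum>z\<in>{path_prefix \<omega> n}. r (some_path z) * indicator (cylinder z) \<omega>)"
    by (rule sum.mono_neutral_right) (auto simp: finite_words mem_cylinder_iff indicator_def)
  also have "\<dots> = r (some_path (path_prefix \<omega> n))" by simp
  also have "\<dots> = r \<omega>"
    using assms path_prefix_some_path[of "path_prefix \<omega> n"]
    by (intro depends_on_prefixD[where n = n]) auto
  finally show ?thesis by simp
qed

lemma finite_range_depends_on_prefix:
  fixes r :: "'x::finite path \<Rightarrow> real"
  assumes "depends_on_prefix n r"
  shows "finite (range r)"
proof -
  have "r \<omega> = r (some_path (path_prefix \<omega> n))" for \<omega>
    using assms path_prefix_some_path[of "path_prefix \<omega> n"]
    by (intro depends_on_prefixD[where n = n]) auto
  then have "range r \<subseteq> (\<lambda>z. r (some_path z)) ` {z. length z = n}" by force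
  then show ?thesis using finite_words finite_surj by blast
qed

lemma finitary_gambles_iff:
  fixes f :: "'x::finite global_var"
  shows "f \<in> finitary_gambles \<longleftrightarrow> (\<exists>n r. depends_on_prefix n r \<and> f = (\<lambda>\<omega>. ereal (r \<omega>)))"
proof
  assume "f \<in> finitary_gambles"
  then have "finitary f" "gamble f" by (simp_all add: finitary_gambles_def)
  obtain n where n: "n_measurable n f"
    using \<open>finitary f\<close> unfolding finitary_def ..
  obtain c where c: "\<forall>\<omega>. \<bar>f \<omega>\<bar> \<le> ereal c"
    using \<open>gamble f\<close> unfolding gamble_def ..
  have f: "f \<omega> = ereal (real_of_ereal (f \<omega>))" for \<omega>
    using spec[OF c, of \<omega>] by (cases "f \<omega>") auto
  moreover have "depends_on_prefix n (\<lambda>\<omega>. real_of_ereal (f \<omega>))"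
    unfolding depends_on_prefix_def
    by (intro allI impI arg_cong[where f = real_of_ereal])
      (rule n[unfolded n_measurable_def, rule_format])
  ultimately show "\<exists>n r. depends_on_prefix n r \<and> f = (\<lambda>\<omega>. ereal (r \<omega>))"
    by (intro exI conjI) (assumption, rule ext)
next
  assume "\<exists>n r. depends_on_prefix n r \<and> f = (\<lambda>\<omega>. ereal (r \<omega>))"
  then obtain n r where r: "depends_on_prefix n r" and f: "f = (\<lambda>\<omega>. ereal (r \<omega>))"
    by (elim exE conjE)
  have "bounded (range r)"
    using finite_range_depends_on_prefix[OF r] by (rule finite_imp_bounded)
  then obtain c where "\<And>\<omega>. \<bar>r \<omega>\<bar> \<le> c" unfolding bounded_iff by auto
  then have "gamble f" unfolding gamble_def f by auto
  moreover have "n_measurable n f"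
    unfolding n_measurable_def f by (intro allI impI arg_cong[where f = ereal]) (rule depends_on_prefixD[OF r])
  ultimately show "f \<in> finitary_gambles"
    by (auto simp: finitary_gambles_def finitary_def)
qed

lemma finitary_gambleI:
  fixes r :: "'x::finite path \<Rightarrow> real"
  assumes "depends_on_prefix n r"
  shows "(\<lambda>\<omega>. ereal (r \<omega>)) \<in> finitary_gambles"
  unfolding finitary_gambles_iff using assms by (intro exI[of _ n] exI[of _ r]) simp

lemma borel_measurable_depends_on_prefix:
  fixes r :: "'x::finite path \<Rightarrow> real"
  assumes "depends_on_prefix n r"
  shows "r \<in> borel_measurable path_algebra"
proof -
  have "(\<lambda>\<omega>. \<Sum>z | length z = n. r (some_path z) * indicator (cylinder z) \<omega>) \<in> borel_measurable path_algebra"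
    by measurable
  then show ?thesis by (simp only: depends_on_prefix_expand[OF assms, symmetric])
qed

lemma borel_measurable_finitary_gamble:
  fixes f :: "'x::finite global_var"
  assumes "f \<in> finitary_gambles"
  shows "f \<in> borel_measurable path_algebra"
proof -
  obtain n r where r: "depends_on_prefix n r" and f: "f = (\<lambda>\<omega>. ereal (r \<omega>))"
    using assms unfolding finitary_gambles_iff by (elim exE conjE)
  show ?thesis
    unfolding f by (intro borel_measurable_ereal borel_measurable_depends_on_prefix[OF r])
qed

lemma
  fixes p :: "'x::finite prob_tree"
  assumes "depends_on_prefix n r"
  shows integrable_depends_on_prefix: "integrable (path_measure p s) r"
    and integral_depends_on_prefix:
      "integral\<^sup>L (path_measure p s) r = (\<Sum>z | length z = n. r (some_path z) * cylinder_prob p s z)"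
proof -
  interpret prob_space "path_measure p s" by (rule prob_space_path_measure)
  let ?t = "\<lambda>z \<omega>. r (some_path z) * indicator (cylinder z) \<omega>"
  have i: "integrable (path_measure p s) (?t z)" for z
    by (intro integrable_mult_right integrable_real_indicator)
      (auto simp: sets_path_measure emeasure_eq_measure)
  have "integrable (path_measure p s) (\<lambda>\<omega>. \<Sum>z | length z = n. ?t z \<omega>)"
    by (intro Bochner_Integration.integrable_sum i)
  then show "integrable (path_measure p s) r"
    by (simp only: depends_on_prefix_expand[OF assms, symmetric])
  have "(\<integral>\<omega>. (\<Sum>z | length z = n. ?t z \<omega>) \<partial>path_measure p s)
      = (\<Sum>z | length z = n. r (some_path z) * cylinder_prob p s z)"
    by (subst Bochner_Integration.integral_sum[OF i]) (simp add: measure_path_measure_cylinder)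
  then show "integral\<^sup>L (path_measure p s) r = (\<Sum>z | length z = n. r (some_path z) * cylinder_prob p s z)"
    by (simp only: depends_on_prefix_expand[OF assms, symmetric])
qed

lemma cylinder_prob_step:
  fixes p :: "'x::finite prob_tree"
  shows "cylinder_prob p s z = (\<Sum>x\<in>UNIV. pmf (p s) x * cylinder_prob p (s @ [x]) z)"
proof (cases "length z \<le> length s")
  case True
  have "cylinder_prob p (s @ [x]) z = cylinder_prob p s z" for x
    using True by (simp add: cylinder_prob_def)
  moreover have "(\<Sum>x\<in>UNIV. pmf (p s) x) = 1"
    by (rule sum_pmf_eq_1) auto
  ultimately show ?thesis by (simp flip: sum_distrib_right)
next
  case False
  then have len: "length s < length z" by simp
  have eq: "take (Suc (length s)) z = s @ [x] \<longleftrightarrow> take (length s) z = s \<and> x = z ! length s" for x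
    using len by (auto simp: take_Suc_conv_app_nth)
  have step: "cylinder_prob p (s @ [x]) z = (if take (length s) z = s \<and> x = z ! length s
      then \<Prod>i=Suc (length s)..<length z. pmf (p (take i z)) (z ! i) else 0)" for x
  proof (cases "length z = Suc (length s)")
    case True
    then show ?thesis using eq[of x] by (auto simp: cylinder_prob_def)
  next
    case False
    then show ?thesis using eq[of x] len by (auto simp: cylinder_prob_def)
  qed
  show ?thesis
  proof (cases "take (length s) z = s")
    case True
    have "(\<Sum>x\<in>UNIV. pmf (p s) x * cylinder_prob p (s @ [x]) z)
        = (\<Sum>x\<in>UNIV. if x = z ! length s then pmf (p s) (z ! length s) *
            (\<Prod>i=Suc (length s)..<length z. pmf (p (take i z)) (z ! i)) else 0)"
      by (rule sum.cong) (auto simp: step True)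
    also have "\<dots> = pmf (p s) (z ! length s) *
        (\<Prod>i=Suc (length s)..<length z. pmf (p (take i z)) (z ! i))" by simp
    also have "\<dots> = cylinder_prob p s z"
      using len True by (simp add: cylinder_prob_def prod.atLeast_Suc_lessThan)
    finally show ?thesis by simp
  next
    case False
    then show ?thesis using len unfolding step by (simp add: cylinder_prob_def)
  qed
qed

text \<open>This is the law of total expectation for the first step after \<open>s\<close>. A finitary function is a
  finite combination of indicators of cylinders, so it is enough to know it for cylinders.\<close>

lemma integral_tree_step:
  fixes p :: "'x::finite prob_tree"
  assumes r: "depends_on_prefix n r"
  shows "integral\<^sup>L (path_measure p s) r =
    local_exp p s (\<lambda>x. integral\<^sup>L (path_measure p (s @ [x])) r)"
proof -
  have "integral\<^sup>L (path_measure p s) r =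
      (\<Sum>z | length z = n. \<Sum>x\<in>UNIV. r (some_path z) * cylinder_prob p (s @ [x]) z * pmf (p s) x)"
    by (simp add: integral_depends_on_prefix[OF r] cylinder_prob_step[where p = p and s = s] sum_distrib_left ac_simps)
  also have "\<dots> = local_exp p s (\<lambda>x. integral\<^sup>L (path_measure p (s @ [x])) r)"
    unfolding local_exp_def integral_depends_on_prefix[OF r] sum_distrib_right by (rule sum.swap)
  finally show ?thesis .
qed

lemma AE_path_measure_cylinder:
  fixes p :: "'x::finite prob_tree"
  shows "AE \<omega> in path_measure p s. \<omega> \<in> cylinder s"
proof -
  interpret prob_space "path_measure p s" by (rule prob_space_path_measure)
  have "prob (cylinder s) = 1"
    by (simp add: measure_path_measure_cylinder cylinder_prob_def)
  then show ?thesis by (rule AE_prob_1)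
qed

lemma integral_cong_on_cylinder:
  fixes p :: "'x::finite prob_tree"
  assumes "depends_on_prefix m q" "depends_on_prefix n r" "\<And>\<omega>. \<omega> \<in> cylinder s \<Longrightarrow> q \<omega> = r \<omega>"
  shows "integral\<^sup>L (path_measure p s) q = integral\<^sup>L (path_measure p s) r"
proof (rule integral_cong_AE)
  show "AE \<omega> in path_measure p s. q \<omega> = r \<omega>"
    using AE_path_measure_cylinder[where p = p and s = s] assms(3) by auto
qed (use assms(1,2) in \<open>auto intro: integrable_depends_on_prefix borel_measurable_integrable\<close>)

lemma integral_constant_on_cylinder:
  fixes p :: "'x::finite prob_tree"
  assumes "depends_on_prefix n r" "\<And>\<omega>. \<omega> \<in> cylinder s \<Longrightarrow> r \<omega> = c"
  shows "integral\<^sup>L (path_measure p s) r = c"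
  using integral_cong_on_cylinder[OF assms(1) depends_on_prefix_const[of 0 c] assms(2)]
  by (simp add: prob_space.prob_space[OF prob_space_path_measure, simplified])

lemma integral_next_state:
  fixes p :: "'x::finite prob_tree"
  shows "integral\<^sup>L (path_measure p s) (\<lambda>\<omega>. h (\<omega> (length s))) = local_exp p s h"
proof -
  have "integral\<^sup>L (path_measure p (s @ [x])) (\<lambda>\<omega>. h (\<omega> (length s))) = h x" for x
    by (rule integral_constant_on_cylinder[OF depends_on_prefix_state])
      (auto simp: mem_cylinder_iff path_prefix_Suc)
  then show ?thesis
    by (simp add: integral_tree_step[OF depends_on_prefix_state, where s = s])
qed

section \<open>The measure-theoretic upper expectation on bounded below measurable variables\<close>

lemma E_meas_mono: "f \<le> g \<Longrightarrow> E_meas p f s \<le> E_meas p g s"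
  unfolding E_meas_def
  by (intro ereal_minus_mono)
    (auto simp: less_eq_ennreal.rep_eq[symmetric] le_fun_def intro!: nn_integral_mono e2ennreal_mono max.mono)

lemma E_meas_real:
  assumes "integrable (path_measure p s) r"
  shows "E_meas p (\<lambda>\<omega>. ereal (r \<omega>)) s = ereal (integral\<^sup>L (path_measure p s) r)"
proof -
  have e: "e2ennreal (max 0 (ereal x)) = ennreal x" for x
    by (simp add: ennreal.abs_eq max_def zero_ereal_def ennreal_def)
  obtain a b where ab: "0 \<le> a" "0 \<le> b"
      "(\<integral>\<^sup>+ \<omega>. ennreal (r \<omega>) \<partial>path_measure p s) = ennreal a"
      "(\<integral>\<^sup>+ \<omega>. ennreal (- r \<omega>) \<partial>path_measure p s) = ennreal b"
      "integral\<^sup>L (path_measure p s) r = a - b"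
    by (rule integrableE[OF assms]) blast
  have "e2ennreal (max 0 (- ereal x)) = ennreal (- x)" for x
    using e[of "- x"] by simp
  then show ?thesis
    unfolding E_meas_def e using ab by (simp add: enn2ereal_ennreal)
qed

text \<open>Adding a constant turns the difference of two integrals into a single integral of a nonnegative
  function.\<close>

lemma E_meas_bounded_below:
  fixes p :: "'x::finite prob_tree"
  assumes f: "f \<in> borel_measurable path_algebra" and c: "0 \<le> c" "\<And>\<omega>. ereal (- c) \<le> f \<omega>"
  shows "E_meas p f s = enn2ereal (\<integral>\<^sup>+ \<omega>. e2ennreal (f \<omega> + ereal c) \<partial>path_measure p s) - ereal c"
proof -
  interpret prob_space "path_measure p s" by (rule prob_space_path_measure)
  note [measurable] = f
  define A where "A = (\<integral>\<^sup>+ \<omega>. e2ennreal (max 0 (f \<omega>)) \<partial>path_measure p s)"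
  define B where "B = (\<integral>\<^sup>+ \<omega>. e2ennreal (max 0 (- f \<omega>)) \<partial>path_measure p s)"
  define U where "U = (\<integral>\<^sup>+ \<omega>. e2ennreal (f \<omega> + ereal c) \<partial>path_measure p s)"
  have e: "e2ennreal (max 0 (ereal x)) = ennreal x" "e2ennreal (ereal x) = ennreal x" for x
    by (simp_all add: max_def zero_ereal_def ennreal_def)
  have pos_neg: "e2ennreal (max 0 (f \<omega>)) + ennreal c = e2ennreal (f \<omega> + ereal c) + e2ennreal (max 0 (- f \<omega>))"
    for \<omega>
  proof (cases "f \<omega>")
    case (real x)
    have "ennreal x + ennreal c = ennreal (x + c) + ennreal (- x)"
      using c(1) c(2)[of \<omega>] real by (cases "0 \<le> x") (auto simp: ennreal_neg simp flip: ennreal_plus)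
    then show ?thesis using real e(1)[of x] e(1)[of "-x"] e(2)[of "x + c"] by simp
  next
    case PInf
    then show ?thesis by (simp add: max_def e2ennreal_infty)
  next
    case MInf
    then show ?thesis using c(2)[of \<omega>] by simp
  qed
  have "A + ennreal c = (\<integral>\<^sup>+ \<omega>. e2ennreal (max 0 (f \<omega>)) + ennreal c \<partial>path_measure p s)"
    unfolding A_def by (subst nn_integral_add) (auto simp: emeasure_space_1[simplified])
  also have "\<dots> = U + B"
    unfolding pos_neg U_def B_def by (subst nn_integral_add) auto
  finally have AU: "A + ennreal c = U + B" .
  have neg_le: "e2ennreal (max 0 (- f \<omega>)) \<le> ennreal c" for \<omega>
  proof -
    have "e2ennreal (max 0 (- f \<omega>)) \<le> e2ennreal (ereal c)"
      using c(1) c(2)[of \<omega>] by (intro e2ennreal_mono) (simp add: ereal_uminus_le_reorder)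
    then show ?thesis by (simp add: e)
  qed
  have "B \<le> (\<integral>\<^sup>+ \<omega>. ennreal c \<partial>path_measure p s)"
    unfolding B_def using neg_le by (intro nn_integral_mono)
  then have "B \<le> ennreal c" by (simp add: emeasure_space_1[simplified])
  then obtain b where b: "B = ennreal b" "0 \<le> b"
    by (cases B) (auto simp: top_unique)
  have "enn2ereal A - enn2ereal B = enn2ereal U - ereal c"
  proof (cases U)
    case (real u)
    then obtain a where a: "A = ennreal a" "0 \<le> a"
      using AU b by (cases A) (auto simp flip: ennreal_plus)
    then have "a + c = u + b" using AU b real c(1) by (simp flip: ennreal_plus)
    then show ?thesis using a b real by (simp add: enn2ereal_ennreal)
  next
    case top
    then have "A = \<top>" using AU by (cases A) (auto simp flip: ennreal_plus)
    then show ?thesis using b top by (simp add: enn2ereal_ennreal)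
  qed
  then show ?thesis unfolding E_meas_def A_def B_def U_def .
qed

lemma upper_E_meas_eq_E_meas:
  assumes "bounded_below f" "f \<in> borel_measurable path_algebra"
  shows "upper_E_meas p f s = E_meas p f s"
  unfolding upper_E_meas_def
  by (rule antisym) (use assms in \<open>auto intro!: INF_lower INF_greatest E_meas_mono\<close>)

lemma bounded_below_finitary_gamble:
  assumes "f \<in> finitary_gambles"
  shows "bounded_below f"
proof -
  have "gamble f" using assms by (simp add: finitary_gambles_def)
  then obtain c where c: "\<forall>\<omega>. \<bar>f \<omega>\<bar> \<le> ereal c"
    unfolding gamble_def ..
  have "ereal (- c) \<le> f \<omega>" for \<omega>
    using spec[OF c, of \<omega>] by (cases "f \<omega>") auto
  then show ?thesis unfolding bounded_below_def by blast
qed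

lemma upper_E_meas_finitary:
  fixes p :: "'x::finite prob_tree"
  assumes "depends_on_prefix n r"
  shows "upper_E_meas p (\<lambda>\<omega>. ereal (r \<omega>)) s = ereal (integral\<^sup>L (path_measure p s) r)"
proof -
  have "(\<lambda>\<omega>. ereal (r \<omega>)) \<in> finitary_gambles"
    using assms by (rule finitary_gambleI)
  then have "upper_E_meas p (\<lambda>\<omega>. ereal (r \<omega>)) s = E_meas p (\<lambda>\<omega>. ereal (r \<omega>)) s"
    using borel_measurable_depends_on_prefix[OF assms]
    by (intro upper_E_meas_eq_E_meas bounded_below_finitary_gamble) auto
  then show ?thesis
    by (simp add: E_meas_real integrable_depends_on_prefix[OF assms])
qed

text \<open>Fatou's lemma concerns nonnegative functions, hence the shift by \<open>c\<close>. The argument goes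
  by contradiction with a real \<open>b\<close> strictly between the two sides, which keeps all differences with
  \<open>c\<close> away from infinite values.\<close>

lemma E_meas_Fatou:
  fixes p :: "'x::finite prob_tree" and F :: "nat \<Rightarrow> 'x global_var"
  assumes F: "\<And>n. F n \<in> borel_measurable path_algebra"
    and c: "0 \<le> c" "\<And>n \<omega>. ereal (- c) \<le> F n \<omega>"
    and lim: "\<And>\<omega>. (\<lambda>n. F n \<omega>) \<longlonglongrightarrow> f \<omega>"
  shows "E_meas p f s \<le> limsup (\<lambda>n. E_meas p (F n) s)"
proof (rule ccontr)
  note [measurable] = F
  have f_liminf: "f = (\<lambda>\<omega>. liminf (\<lambda>n. F n \<omega>))"
    using lim_imp_Liminf[OF _ lim] by auto
  have f: "f \<in> borel_measurable path_algebra" unfolding f_liminf by measurable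
  have cf: "ereal (- c) \<le> f \<omega>" for \<omega>
    using c(2) by (intro LIMSEQ_le_const[OF lim]) auto
  define I where "I g = (\<integral>\<^sup>+ \<omega>. e2ennreal (g \<omega> + ereal c) \<partial>path_measure p s)" for g
  have EF: "E_meas p (F n) s = enn2ereal (I (F n)) - ereal c" for n
    unfolding I_def using F c by (rule E_meas_bounded_below)
  have Ef: "E_meas p f s = enn2ereal (I f) - ereal c"
    unfolding I_def using f c(1) cf by (rule E_meas_bounded_below)
  assume "\<not> E_meas p f s \<le> limsup (\<lambda>n. E_meas p (F n) s)"
  then obtain b where b: "limsup (\<lambda>n. E_meas p (F n) s) < ereal b" "ereal b < E_meas p f s"
    using ereal_dense2 by (metis not_le)
  have ev: "eventually (\<lambda>n. E_meas p (F n) s < ereal b) sequentially"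
    using b(1) by (rule Limsup_lessD)
  have le: "enn2ereal (I (F n)) \<le> ereal (b + c)" if "E_meas p (F n) s < ereal b" for n
    using that unfolding EF by (cases "enn2ereal (I (F n))") auto
  have bc: "0 \<le> b + c"
  proof -
    obtain n where "E_meas p (F n) s < ereal b"
      using eventually_happens'[OF _ ev] by auto
    from order_trans[OF enn2ereal_nonneg le[OF this]] show ?thesis by simp
  qed
  have "I (F n) \<le> ennreal (b + c)" if "E_meas p (F n) s < ereal b" for n
    using le[OF that] bc by (simp add: less_eq_ennreal.rep_eq enn2ereal_ennreal)
  then have "limsup (\<lambda>n. I (F n)) \<le> ennreal (b + c)"
    using ev by (intro Limsup_bounded) (auto elim: eventually_mono)
  then have lI: "liminf (\<lambda>n. I (F n)) \<le> ennreal (b + c)"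
    using Liminf_le_Limsup[of sequentially "\<lambda>n. I (F n)"] by (auto intro: order_trans)
  have "(\<lambda>n. e2ennreal (F n \<omega> + ereal c)) \<longlonglongrightarrow> e2ennreal (f \<omega> + ereal c)" for \<omega>
    by (intro tendsto_e2ennrealI tendsto_add_ereal_general lim tendsto_const) auto
  then have "(\<lambda>\<omega>. e2ennreal (f \<omega> + ereal c)) = (\<lambda>\<omega>. liminf (\<lambda>n. e2ennreal (F n \<omega> + ereal c)))"
    by (intro ext lim_imp_Liminf[symmetric]) simp_all
  then have "I f \<le> liminf (\<lambda>n. I (F n))"
    unfolding I_def by (simp only:) (rule nn_integral_liminf, measurable)
  with lI have "I f \<le> ennreal (b + c)" by simp
  then have "enn2ereal (I f) \<le> ereal (b + c)"
    using bc by (simp add: less_eq_ennreal.rep_eq enn2ereal_ennreal)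
  then have "E_meas p f s \<le> ereal b"
    unfolding Ef by (cases "enn2ereal (I f)") auto
  with b(2) show False by simp
qed

section \<open>The measure-theoretic upper expectation satisfies the axioms\<close>

lemma P1_upper_E_meas: "P1 p (upper_E_meas p)"
  unfolding P1_def by (simp add: upper_E_meas_finitary[OF depends_on_prefix_state] integral_next_state)

lemma times_indicator_ereal:
  "(\<lambda>\<omega>. ereal (r \<omega>) * indicator A \<omega>) = (\<lambda>\<omega>. ereal (r \<omega> * indicator A \<omega>))"
  by (auto simp: indicator_def)

lemma P2_upper_E_meas: 
  fixes p :: "'x::finite prob_tree"
  shows "P2 (upper_E_meas p)"
  unfolding P2_def
proof (intro ballI allI)
  fix f :: "'x global_var" and s assume "f \<in> finitary_gambles"
  then obtain n r where r: "depends_on_prefix n r" and f: "f = (\<lambda>\<omega>. ereal (r \<omega>))"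
    unfolding finitary_gambles_iff by blast
  note r' = depends_on_prefix_times_cylinder[OF r, of s]
  have "integral\<^sup>L (path_measure p s) r = integral\<^sup>L (path_measure p s) (\<lambda>\<omega>. r \<omega> * indicator (cylinder s) \<omega>)"
    by (rule integral_cong_on_cylinder[OF r r']) auto
  then show "upper_E_meas p f s = upper_E_meas p (\<lambda>\<omega>. f \<omega> * indicator (cylinder s) \<omega>) s"
    unfolding f times_indicator_ereal
    by (simp add: upper_E_meas_finitary[OF r] upper_E_meas_finitary[OF r'])
qed

lemma P3_upper_E_meas:
  fixes p :: "'x::finite prob_tree"
  shows "P3 (upper_E_meas p)"
  unfolding P3_def
proof (intro ballI allI)
  fix f :: "'x global_var" and m and \<omega> :: "'x path" assume "f \<in> finitary_gambles"
  then obtain n r where r: "depends_on_prefix n r" and f: "f = (\<lambda>\<omega>. ereal (r \<omega>))"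
    unfolding finitary_gambles_iff by blast
  define q where "q t = integral\<^sup>L (path_measure p t) r" for t
  let ?s = "path_prefix \<omega> m"
  have q: "depends_on_prefix (Suc m) (\<lambda>\<omega>'. q (path_prefix \<omega>' (Suc m)))"
    by (rule depends_on_prefix_compose)
  have const: "integral\<^sup>L (path_measure p (?s @ [x])) (\<lambda>\<omega>'. q (path_prefix \<omega>' (Suc m))) = q (?s @ [x])" for x
    by (rule integral_constant_on_cylinder[OF q]) (auto simp: mem_cylinder_iff)
  have "q ?s = local_exp p ?s (\<lambda>x. q (?s @ [x]))"
    unfolding q_def by (rule integral_tree_step[OF r])
  also have "\<dots> = integral\<^sup>L (path_measure p ?s) (\<lambda>\<omega>'. q (path_prefix \<omega>' (Suc m)))"
    unfolding const[symmetric] by (rule integral_tree_step[OF q, symmetric])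
  finally have "q ?s = integral\<^sup>L (path_measure p ?s) (\<lambda>\<omega>'. q (path_prefix \<omega>' (Suc m)))" .
  then show "upper_E_meas p f ?s \<le>
      upper_E_meas p (\<lambda>\<omega>'. upper_E_meas p f (path_prefix \<omega>' (m + 1))) ?s"
    unfolding f by (simp add: upper_E_meas_finitary[OF r] upper_E_meas_finitary[OF q] flip: q_def)
qed

lemma P4_upper_E_meas: "P4 (upper_E_meas p)"
  unfolding P4_def upper_E_meas_def by (auto intro!: INF_superset_mono intro: order_trans)

lemma P5_upper_E_meas:
  fixes p :: "'x::finite prob_tree"
  shows "P5 (upper_E_meas p)"
  unfolding P5_def
proof (intro allI impI)
  fix F :: "nat \<Rightarrow> 'x global_var" and f s
  assume fin: "\<forall>n. F n \<in> finitary_gambles" and "\<exists>c::real. \<forall>n \<omega>. ereal c \<le> F n \<omega>"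
    and lim: "\<forall>\<omega>. (\<lambda>n. F n \<omega>) \<longlonglongrightarrow> f \<omega>"
  then obtain c0 :: real where c0: "\<And>n \<omega>. ereal c0 \<le> F n \<omega>" by blast
  define c where "c = \<bar>c0\<bar>"
  have c: "0 \<le> c" "\<And>n \<omega>. ereal (- c) \<le> F n \<omega>"
    using c0 by (auto simp: c_def intro: order_trans[OF _ c0])
  have F [measurable]: "F n \<in> borel_measurable path_algebra" for n
    using fin by (blast intro: borel_measurable_finitary_gamble)
  have "f = (\<lambda>\<omega>. liminf (\<lambda>n. F n \<omega>))"
    using lim_imp_Liminf[OF _ lim[rule_format]] by auto
  then have f: "f \<in> borel_measurable path_algebra" by simp
  have "ereal (- c) \<le> f \<omega>" for \<omega>
    using c(2) by (intro LIMSEQ_le_const[OF lim[rule_format]]) auto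
  then have "bounded_below f" unfolding bounded_below_def by blast
  then have "upper_E_meas p f s = E_meas p f s"
    using f by (rule upper_E_meas_eq_E_meas)
  also have "\<dots> \<le> limsup (\<lambda>n. E_meas p (F n) s)"
    using F c lim by (intro E_meas_Fatou) auto
  also have "(\<lambda>n. E_meas p (F n) s) = (\<lambda>n. upper_E_meas p (F n) s)"
    using F fin by (simp add: upper_E_meas_eq_E_meas bounded_below_finitary_gamble)
  finally show "upper_E_meas p f s \<le> limsup (\<lambda>n. upper_E_meas p (F n) s)" .
qed

section \<open>The axioms force domination by the measure-theoretic upper expectation\<close>

text \<open>Backward induction on the number of states that \<open>r\<close> still has to read. P3 and P4 replace
  \<open>r\<close> by its conditional expectations one state further, and P2 identifies the result, under the
  condition \<open>s\<close>, with a function of the next state only, whose value P1 prescribes. At the end of the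
  induction \<open>r\<close> is constant on the cylinder of \<open>s\<close>.\<close>

lemma axioms_le_integral:
  fixes p :: "'x::finite prob_tree"
  assumes P1: "P1 p E" and P2: "P2 E" and P3: "P3 E" and P4: "P4 E"
    and r: "depends_on_prefix n r"
  shows "E (\<lambda>\<omega>. ereal (r \<omega>)) s \<le> ereal (integral\<^sup>L (path_measure p s) r)"
proof -
  have gamble: "(\<lambda>\<omega>. ereal (q \<omega>)) \<in> finitary_gambles"
    if "depends_on_prefix m q" for m and q :: "'x path \<Rightarrow> real"
    using that by (rule finitary_gambleI)
  have local: "E (\<lambda>\<omega>. ereal (q \<omega>)) s = ereal (local_exp p s h)"
    if "depends_on_prefix m q" "\<And>\<omega>. \<omega> \<in> cylinder s \<Longrightarrow> q \<omega> = h (\<omega> (length s))" for m q h s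
  proof -
    have eq: "(\<lambda>\<omega>. ereal (q \<omega>) * indicator (cylinder s) \<omega>)
        = (\<lambda>\<omega>. ereal (h (\<omega> (length s))) * indicator (cylinder s) \<omega>)"
      using that(2) by (auto simp: indicator_def)
    have "E (\<lambda>\<omega>. ereal (q \<omega>)) s = E (\<lambda>\<omega>. ereal (q \<omega>) * indicator (cylinder s) \<omega>) s"
      by (rule P2[unfolded P2_def, rule_format, OF gamble[OF that(1)]])
    also have "\<dots> = E (\<lambda>\<omega>. ereal (h (\<omega> (length s)))) s"
      unfolding eq
      by (rule P2[unfolded P2_def, rule_format, OF gamble[OF depends_on_prefix_state], symmetric])
    also have "\<dots> = ereal (local_exp p s h)"
      using P1 unfolding P1_def by simp
    finally show ?thesis .
  qed
  show ?thesis
  proof (induction "n - length s" arbitrary: s)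
    case 0
    \<comment> \<open>The situation already determines \<open>r\<close>, so P1 is applied to a constant function of the next state.\<close>
    define c where "c = r (some_path s)"
    have c: "r \<omega> = c" if "\<omega> \<in> cylinder s" for \<omega>
      unfolding c_def
      by (rule depends_on_prefixD[OF r], rule path_prefix_eq_mono[of _ "length s"])
        (use 0 that in \<open>simp_all add: mem_cylinder_iff\<close>)
    have "local_exp p s (\<lambda>_. c) = c"
      by (simp add: local_exp_def sum_pmf_eq_1 flip: sum_distrib_left)
    then have "E (\<lambda>\<omega>. ereal (r \<omega>)) s = ereal c"
      by (subst local[OF r c]) simp_all
    then show ?case
      by (subst integral_constant_on_cylinder[OF r c]) simp_all
  next
    case (Suc d)
    define q where "q t = integral\<^sup>L (path_measure p t) r" for t
    let ?g = "\<lambda>\<omega>. q (path_prefix \<omega> (Suc (length s)))"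
    have "E (\<lambda>\<omega>. ereal (r \<omega>)) s \<le> E (\<lambda>\<omega>. E (\<lambda>\<omega>. ereal (r \<omega>)) (path_prefix \<omega> (Suc (length s)))) s"
      using P3[unfolded P3_def, rule_format, OF gamble[OF r], of "some_path s" "length s"] by simp
    also have "\<dots> \<le> E (\<lambda>\<omega>. ereal (?g \<omega>)) s"
    proof (rule P4[unfolded P4_def, rule_format])
      show "(\<lambda>\<omega>. E (\<lambda>\<omega>. ereal (r \<omega>)) (path_prefix \<omega> (Suc (length s)))) \<le> (\<lambda>\<omega>. ereal (?g \<omega>))"
        unfolding q_def using Suc.hyps(2) by (intro le_funI Suc.hyps(1)) simp
    qed
    also have "\<dots> = ereal (local_exp p s (\<lambda>x. q (s @ [x])))"
      by (rule local[OF depends_on_prefix_compose]) (simp add: path_prefix_Suc mem_cylinder_iff)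
    also have "\<dots> = ereal (q s)"
      unfolding q_def by (simp only: integral_tree_step[OF r, symmetric])
    finally show ?case unfolding q_def .
  qed
qed

text \<open>The value is \<open>v\<close> rounded up to a multiple of \<open>d\<close>, cut off at \<open>n * d\<close>. It is written as a sum
  over levels because level sets can be replaced by open sets one at a time.\<close>

definition staircase :: "real \<Rightarrow> ereal \<Rightarrow> nat \<Rightarrow> real" where
  "staircase d v n = d * (\<Sum>k<n. of_bool (ereal (real k * d) < v))"

lemma staircase_bounds:
  assumes d: "0 < d" and v: "0 \<le> v"
  shows "min v (ereal (real n * d)) \<le> ereal (staircase d v n)"
    and "ereal (staircase d v n) \<le> v + ereal d"
proof -
  have "min v (ereal (real n * d)) \<le> ereal (staircase d v n) \<and> ereal (staircase d v n) \<le> v + ereal d"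
  proof (cases v)
    case (real x)
    have "staircase d v n \<le> real n * d \<and> min x (real n * d) \<le> staircase d v n \<and> staircase d v n \<le> x + d"
    proof (induction n)
      case 0
      then show ?case using v d by (simp add: staircase_def real)
    next
      case (Suc n)
      have "staircase d v (Suc n) = staircase d v n + (if real n * d < x then d else 0)"
        by (simp add: staircase_def real distrib_left)
      moreover have "real (Suc n) * d = real n * d + d" by (simp add: algebra_simps)
      ultimately show ?case using Suc d by (auto simp: min_def split: if_splits)
    qed
    then show ?thesis using real by (auto simp: min_def)
  next
    case PInf
    then show ?thesis by (simp add: staircase_def mult.commute)
  next
    case MInf
    then show ?thesis using v by simp
  qed
  then show "min v (ereal (real n * d)) \<le> ereal (staircase d v n)"
    "ereal (staircase d v n) \<le> v + ereal d" by auto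
qed

definition inner_approx :: "'x path set \<Rightarrow> nat \<Rightarrow> 'x path set" where
  "inner_approx U n = {\<omega>. cylinder (path_prefix \<omega> n) \<subseteq> U}"

lemma inner_approx_subset: "inner_approx U n \<subseteq> U"
  unfolding inner_approx_def using path_prefix_mem_cylinder by blast

lemma inner_approx_mono: "m \<le> n \<Longrightarrow> inner_approx U m \<subseteq> inner_approx U n"
  unfolding inner_approx_def using cylinder_path_prefix_antimono by blast

lemma eventually_inner_approx:
  assumes "prefix_open U" "\<omega> \<in> U"
  shows "eventually (\<lambda>n. \<omega> \<in> inner_approx U n) sequentially"
proof -
  obtain m where m: "\<omega> \<in> inner_approx U m"
    using assms unfolding prefix_open_def inner_approx_def by blast
  show ?thesis
    by (rule eventually_sequentiallyI[of m]) (rule subsetD[OF inner_approx_mono m])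
qed

lemma depends_on_prefix_inner_approx: "depends_on_prefix n (indicator (inner_approx U n))"
  unfolding depends_on_prefix_def inner_approx_def indicator_def by simp

lemma prefix_open_inner_approx: "prefix_open (inner_approx U n)"
  unfolding prefix_open_def
proof
  fix \<omega> assume *: "\<omega> \<in> inner_approx U n"
  have "cylinder (path_prefix \<omega> n) \<subseteq> inner_approx U n"
  proof
    fix \<omega>' assume "\<omega>' \<in> cylinder (path_prefix \<omega> n)"
    then have "path_prefix \<omega>' n = path_prefix \<omega> n" by (simp add: mem_cylinder_iff)
    then show "\<omega>' \<in> inner_approx U n" using * by (simp add: inner_approx_def)
  qed
  then show "\<exists>m. cylinder (path_prefix \<omega> m) \<subseteq> inner_approx U n" ..
qed

text \<open>This plays the part of the Vitali--Caratheodory theorem. The staircase replaces \<open>v\<close> by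
  countably many level sets at a cost of at most the step height \<open>d\<close>. Each level set is enlarged to
  an open set \<open>U k\<close>, the \<open>k\<close>-th at a cost of at most \<open>d / 2 ^ Suc k\<close>, and the open sets are exhausted
  by finitary ones; the \<open>n\<close>-th approximation keeps \<open>n\<close> levels and looks at \<open>n\<close> states. The total cost is
  \<open>2 * d\<close>, which is why \<open>d\<close> is half of the permitted error.\<close>

lemma finitary_approximation_from_above:
  fixes M :: "'x::finite path measure" and v :: "'x global_var"
  assumes "prob_space M" and sets_M: "sets M = sets path_algebra"
    and v_meas: "v \<in> borel_measurable path_algebra" and v0: "\<And>\<omega>. 0 \<le> v \<omega>"
    and i: "0 \<le> i" "(\<integral>\<^sup>+ \<omega>. e2ennreal (v \<omega>) \<partial>M) = ennreal i" and "0 < e"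
  obtains q :: "nat \<Rightarrow> 'x path \<Rightarrow> real"
  where "\<And>n. depends_on_prefix n (q n)" "\<And>n \<omega>. 0 \<le> q n \<omega>" "\<And>\<omega>. incseq (\<lambda>n. q n \<omega>)"
    "\<And>\<omega>. v \<omega> \<le> (SUP n. ereal (q n \<omega>))" "\<And>n. integrable M (q n)" "\<And>n. integral\<^sup>L M (q n) \<le> i + e"
proof -
  interpret prob_space M by fact
  have spM: "space M = UNIV" using sets_eq_imp_space_eq[OF sets_M] by simp
  have [measurable]: "v \<in> borel_measurable M"
    using v_meas by (simp cong: measurable_cong_sets add: measurable_cong_sets[OF sets_M refl])
  define d where "d = e / 2"
  have d: "0 < d" using \<open>0 < e\<close> by (simp add: d_def)
  define A where "A k = {\<omega>. ereal (real k * d) < v \<omega>}" for k :: nat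
  have A_sets: "A k \<in> sets M" for k
  proof -
    have "{\<omega> \<in> space M. ereal (real k * d) < v \<omega>} \<in> sets M" by measurable
    then show ?thesis by (simp add: A_def spM)
  qed
  have "\<exists>U. prefix_open U \<and> A k \<subseteq> U \<and> prob U \<le> prob (A k) + (1/2) ^ Suc k" for k
    by (rule outer_regular_path_measure[OF finite_measure_axioms sets_M A_sets[unfolded sets_M],
          of "(1/2) ^ Suc k" k]) auto
  then obtain U where U: "\<And>k. prefix_open (U k)" "\<And>k. A k \<subseteq> U k"
    "\<And>k. prob (U k) \<le> prob (A k) + (1/2) ^ Suc k" by metis
  define q where "q n \<omega> = d * (\<Sum>k<n. indicator (inner_approx (U k) n) \<omega>)" for n \<omega>
  have dep: "depends_on_prefix n (q n)" for n
    unfolding depends_on_prefix_def q_def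
  proof (intro allI impI)
    fix \<omega> \<omega>' :: "'x path" assume *: "path_prefix \<omega> n = path_prefix \<omega>' n"
    have "indicator (inner_approx (U k) n) \<omega> = (indicator (inner_approx (U k) n) \<omega>' :: real)" for k
      by (rule depends_on_prefixD[OF depends_on_prefix_inner_approx *])
    then show "d * (\<Sum>k<n. indicator (inner_approx (U k) n) \<omega>)
        = d * (\<Sum>k<n. indicator (inner_approx (U k) n) \<omega>')" by simp
  qed
  have nonneg: "0 \<le> q n \<omega>" for n \<omega>
    unfolding q_def using d by (simp add: sum_nonneg)
  have mono: "q m \<omega> \<le> q n \<omega>" if "m \<le> n" for m n \<omega>
  proof -
    have "(\<Sum>k<m. indicator (inner_approx (U k) m) \<omega> :: real) \<le> (\<Sum>k<m. indicator (inner_approx (U k) n) \<omega>)"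
      using inner_approx_mono[OF that] by (intro sum_mono) (auto simp: indicator_def)
    also have "\<dots> \<le> (\<Sum>k<n. indicator (inner_approx (U k) n) \<omega>)"
      using that by (intro sum_mono2) auto
    finally show ?thesis unfolding q_def using d by simp
  qed
  have stairs: "staircase d (v \<omega>) N = d * (\<Sum>k<N. indicator (A k) \<omega>)" for \<omega> N
    by (simp add: staircase_def A_def indicator_def of_bool_def)
  have below: "min (v \<omega>) (ereal (real N * d)) \<le> (SUP n. ereal (q n \<omega>))" for \<omega> N
  proof -
    \<comment> \<open>Only \<open>N\<close> level sets are involved, so some \<open>n\<close> is late enough for all of them.\<close>
    have "eventually (\<lambda>n. indicator (A k) \<omega> \<le> (indicator (inner_approx (U k) n) \<omega> :: real)) sequentially" for k
    proof (cases "\<omega> \<in> A k")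
      case True
      then show ?thesis
        using eventually_inner_approx[OF U(1)[of k], of \<omega>] U(2)[of k]
        by (auto simp: indicator_def elim!: eventually_mono)
    qed simp
    then have "eventually (\<lambda>n. \<forall>k\<in>{..<N}. indicator (A k) \<omega>
        \<le> (indicator (inner_approx (U k) n) \<omega> :: real)) sequentially"
      by (intro eventually_ball_finite) auto
    moreover have "eventually (\<lambda>n. N \<le> n) sequentially" by (rule eventually_ge_at_top)
    ultimately have "eventually (\<lambda>n. N \<le> n \<and> (\<forall>k<N. indicator (A k) \<omega>
        \<le> (indicator (inner_approx (U k) n) \<omega> :: real))) sequentially"
      by eventually_elim simp
    from eventually_happens'[OF sequentially_bot this]
    obtain n where n: "N \<le> n" "\<forall>k<N. indicator (A k) \<omega> \<le> (indicator (inner_approx (U k) n) \<omega> :: real)"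
      by (elim exE conjE)
    have "(\<Sum>k<N. indicator (A k) \<omega> :: real) \<le> (\<Sum>k<N. indicator (inner_approx (U k) n) \<omega>)"
      using n(2) by (intro sum_mono) auto
    also have "\<dots> \<le> (\<Sum>k<n. indicator (inner_approx (U k) n) \<omega>)"
      using n(1) by (intro sum_mono2) auto
    finally have le: "staircase d (v \<omega>) N \<le> q n \<omega>"
      unfolding q_def stairs using d by simp
    have "min (v \<omega>) (ereal (real N * d)) \<le> ereal (staircase d (v \<omega>) N)"
      by (rule staircase_bounds(1)[OF d v0])
    also have "\<dots> \<le> ereal (q n \<omega>)" using le by simp
    also have "\<dots> \<le> (SUP n. ereal (q n \<omega>))" by (rule SUP_upper) simp
    finally show ?thesis .
  qed
  have above: "v \<omega> \<le> (SUP n. ereal (q n \<omega>))" for \<omega>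
  proof (cases "v \<omega>")
    case (real x)
    obtain N where "x \<le> real N * d"
      using spec[OF reals_Archimedean3[OF d], of x] by (auto intro: less_imp_le)
    then show ?thesis using below[of \<omega> N] by (simp add: real min_def)
  next
    case PInf
    have "ereal y \<le> (SUP n. ereal (q n \<omega>))" for y
    proof -
      obtain N where "y \<le> real N * d"
        using spec[OF reals_Archimedean3[OF d], of y] by (auto intro: less_imp_le)
      then have "ereal y \<le> ereal (real N * d)" by simp
      also have "\<dots> \<le> (SUP n. ereal (q n \<omega>))" using below[of \<omega> N] PInf by simp
      finally show ?thesis .
    qed
    then have "(SUP n. ereal (q n \<omega>)) = \<infinity>" by (rule ereal_top)
    then show ?thesis by simp
  qed (use v0[of \<omega>] in simp)
  have K: "inner_approx (U k) n \<in> sets M" for k n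
    by (simp add: sets_M prefix_open_sets[OF prefix_open_inner_approx])
  have integrable: "integrable M (q n)" for n
    unfolding q_def using K by (simp add: emeasure_eq_measure)
  have int: "integral\<^sup>L M (q n) \<le> i + e" for n
  proof -
    have "integral\<^sup>L M (q n) = d * (\<Sum>k<n. prob (inner_approx (U k) n))"
      unfolding q_def using K by (simp add: emeasure_eq_measure spM)
    also have "(\<Sum>k<n. prob (inner_approx (U k) n)) \<le> (\<Sum>k<n. prob (A k) + (1/2) ^ Suc k)"
    proof (rule sum_mono)
      fix k
      have "prob (inner_approx (U k) n) \<le> prob (U k)"
        using inner_approx_subset prefix_open_sets[OF U(1)]
        by (intro finite_measure_mono) (auto simp: sets_M)
      with U(3)[of k] show "prob (inner_approx (U k) n) \<le> prob (A k) + (1/2) ^ Suc k" by simp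
    qed
    also have "\<dots> \<le> (\<Sum>k<n. prob (A k)) + 1"
    proof -
      have "(\<Sum>k<n. (1/2 :: real) ^ Suc k) \<le> 1"
        using sum_le_suminf[OF sums_summable[OF power_half_series], of "{..<n}"]
          sums_unique[OF power_half_series] by auto
      then show ?thesis by (simp add: sum.distrib)
    qed
    finally have 1: "integral\<^sup>L M (q n) \<le> d * ((\<Sum>k<n. prob (A k)) + 1)"
      using d by simp
    have "integral\<^sup>L M (\<lambda>\<omega>. staircase d (v \<omega>) n) = d * (\<Sum>k<n. prob (A k))"
      unfolding stairs by (simp add: emeasure_eq_measure A_sets spM)
    moreover have "integrable M (\<lambda>\<omega>. staircase d (v \<omega>) n)"
      unfolding stairs by (simp add: emeasure_eq_measure A_sets)
    moreover have "0 \<le> staircase d (v \<omega>) n" for \<omega>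
      unfolding staircase_def using d by (intro mult_nonneg_nonneg sum_nonneg) auto
    ultimately have "ennreal (d * (\<Sum>k<n. prob (A k))) = (\<integral>\<^sup>+ \<omega>. ennreal (staircase d (v \<omega>) n) \<partial>M)"
      by (subst nn_integral_eq_integral) auto
    also have "\<dots> \<le> (\<integral>\<^sup>+ \<omega>. e2ennreal (v \<omega>) + ennreal d \<partial>M)"
    proof (rule nn_integral_mono)
      fix \<omega>
      show "ennreal (staircase d (v \<omega>) n) \<le> e2ennreal (v \<omega>) + ennreal d"
      proof (cases "v \<omega>")
        case (real x)
        have "e2ennreal (v \<omega>) = ennreal x" by (simp add: real ennreal_def)
        moreover have "ennreal (staircase d (v \<omega>) n) \<le> ennreal (x + d)"
          using staircase_bounds(2)[OF d v0, of \<omega> n] real by (intro ennreal_leI) simp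
        ultimately show ?thesis using v0[of \<omega>] d real by (simp add: ennreal_plus)
      qed (use v0[of \<omega>] in \<open>simp_all add: e2ennreal_infty\<close>)
    qed
    also have "\<dots> = ennreal (i + d)"
      using i d by (subst nn_integral_add) (auto simp: emeasure_space_1)
    finally have "d * (\<Sum>k<n. prob (A k)) \<le> i + d"
      using i d by (subst (asm) ennreal_le_iff) auto
    moreover have "d * ((\<Sum>k<n. prob (A k)) + 1) = d * (\<Sum>k<n. prob (A k)) + d"
      by (simp add: distrib_left)
    moreover have "e = d + d" by (simp add: d_def)
    ultimately show ?thesis using 1 by linarith
  qed
  show ?thesis
    by (rule that[of q, OF dep nonneg _ above integrable int]) (simp add: incseq_def mono)
qed

text \<open>P5 bounds \<open>E\<close> only along limits of finitary gambles, and these limits are lower semicontinuous.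
  So \<open>g\<close> is first raised to such a limit \<open>h\<close> at a cost of \<open>e\<close> in the integral, which P4 allows.\<close>

lemma axioms_le_E_meas:
  fixes p :: "'x::finite prob_tree"
  assumes P: "P1 p E" "P2 E" "P3 E" "P4 E" "P5 E"
    and g: "g \<in> borel_measurable path_algebra" and bb: "bounded_below g"
  shows "E g s \<le> E_meas p g s"
proof -
  interpret prob_space "path_measure p s" by (rule prob_space_path_measure)
  obtain c0 where c0: "\<And>\<omega>. ereal c0 \<le> g \<omega>"
    using bb unfolding bounded_below_def by blast
  \<comment> \<open>A nonnegative constant is needed to turn the expectation into the integral of \<open>g + c\<close>.\<close>
  define c where "c = \<bar>c0\<bar>"
  have c: "0 \<le> c" "\<And>\<omega>. ereal (- c) \<le> g \<omega>"
    by (auto simp: c_def intro: order_trans[OF _ c0])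
  define v where "v \<omega> = g \<omega> + ereal c" for \<omega>
  have v0: "0 \<le> v \<omega>" for \<omega>
    using c(2)[of \<omega>] unfolding v_def by (cases "g \<omega>") auto
  have v: "v \<in> borel_measurable path_algebra" unfolding v_def using g by measurable
  define I where "I = (\<integral>\<^sup>+ \<omega>. e2ennreal (v \<omega>) \<partial>path_measure p s)"
  have Eg: "E_meas p g s = enn2ereal I - ereal c"
    unfolding I_def v_def using g c by (rule E_meas_bounded_below)
  show ?thesis
  proof (cases I)
    case top
    then show ?thesis unfolding Eg by simp
  next
    case (real i)
    have "E g s \<le> ereal (i - c) + ereal e" if "0 < e" for e
    proof -
      obtain q :: "nat \<Rightarrow> 'x path \<Rightarrow> real" where q: "\<And>n. depends_on_prefix n (q n)" "\<And>n \<omega>. 0 \<le> q n \<omega>"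
        "\<And>\<omega>. incseq (\<lambda>n. q n \<omega>)" "\<And>\<omega>. v \<omega> \<le> (SUP n. ereal (q n \<omega>))"
        "\<And>n. integrable (path_measure p s) (q n)" "\<And>n. integral\<^sup>L (path_measure p s) (q n) \<le> i + e"
        by (rule finitary_approximation_from_above[OF prob_space_path_measure sets_path_measure v v0
              real(1) real(2)[unfolded I_def] \<open>0 < e\<close>]) blast
      define h where "h \<omega> = (SUP n. ereal (q n \<omega>)) + ereal (- c)" for \<omega>
      have dep: "depends_on_prefix n (\<lambda>\<omega>. q n \<omega> - c)" for n
        using q(1)[of n] unfolding depends_on_prefix_def by metis
      have lim: "(\<lambda>n. ereal (q n \<omega> - c)) \<longlonglongrightarrow> h \<omega>" for \<omega>
      proof -
        have "(\<lambda>n. ereal (q n \<omega>)) \<longlonglongrightarrow> (SUP n. ereal (q n \<omega>))"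
          using q(3)[of \<omega>] by (intro LIMSEQ_SUP) (simp add: incseq_def)
        then have "(\<lambda>n. ereal (q n \<omega>) + ereal (- c)) \<longlonglongrightarrow> h \<omega>"
          unfolding h_def by (intro tendsto_add_ereal_general tendsto_const) auto
        then show ?thesis by simp
      qed
      have "g \<le> h"
      proof (rule le_funI)
        fix \<omega>
        have "g \<omega> = v \<omega> + ereal (- c)"
          unfolding v_def using c(2)[of \<omega>] by (cases "g \<omega>") auto
        also have "\<dots> \<le> h \<omega>"
          unfolding h_def by (intro add_right_mono q(4))
        finally show "g \<omega> \<le> h \<omega>" .
      qed
      then have "E g s \<le> E h s"
        by (rule P(4)[unfolded P4_def, rule_format])
      also have "\<dots> \<le> limsup (\<lambda>n. E (\<lambda>\<omega>. ereal (q n \<omega> - c)) s)"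
      proof (rule P(5)[unfolded P5_def, rule_format])
        show "(\<lambda>\<omega>. ereal (q n \<omega> - c)) \<in> finitary_gambles" for n
          using dep by (rule finitary_gambleI)
        show "\<exists>b::real. \<forall>n \<omega>. ereal b \<le> ereal (q n \<omega> - c)"
          using q(2) by (intro exI[of _ "- c"]) simp
      qed (rule lim)
      also have "\<dots> \<le> ereal (i - c + e)"
      proof (rule Limsup_bounded, rule always_eventually, rule allI)
        fix n
        have "E (\<lambda>\<omega>. ereal (q n \<omega> - c)) s \<le> ereal (integral\<^sup>L (path_measure p s) (\<lambda>\<omega>. q n \<omega> - c))"
          by (rule axioms_le_integral[OF P(1-4) dep])
        also have "integral\<^sup>L (path_measure p s) (\<lambda>\<omega>. q n \<omega> - c) = integral\<^sup>L (path_measure p s) (q n) - c"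
          using q(5)[of n] prob_space by simp
        also have "ereal \<dots> \<le> ereal (i - c + e)" using q(6)[of n] by simp
        finally show "E (\<lambda>\<omega>. ereal (q n \<omega> - c)) s \<le> ereal (i - c + e)" .
      qed
      finally show ?thesis by simp
    qed
    then have "E g s \<le> ereal (i - c)" by (rule ereal_le_epsilon2)
    then show ?thesis unfolding Eg using real by (simp add: enn2ereal_ennreal)
  qed
qed

lemma axioms_le_upper_E_meas:
  fixes p :: "'x::finite prob_tree"
  assumes P: "P1 p E" "P2 E" "P3 E" "P4 E" "P5 E"
  shows "E \<le> upper_E_meas p"
proof (intro le_funI)
  fix f :: "'x global_var" and s
  show "E f s \<le> upper_E_meas p f s"
    unfolding upper_E_meas_def
  proof (rule INF_greatest)
    fix g :: "'x global_var"
    assume "g \<in> {g. bounded_below g \<and> g \<in> borel_measurable path_algebra \<and> f \<le> g}"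
    then have g: "bounded_below g" "g \<in> borel_measurable path_algebra" "f \<le> g" by auto
    have "E f s \<le> E g s" by (rule P(4)[unfolded P4_def, rule_format, OF g(3)])
    also have "\<dots> \<le> E_meas p g s" by (rule axioms_le_E_meas[OF P g(2,1)])
    finally show "E f s \<le> E_meas p g s" .
  qed
qed

theorem theorem14:
  fixes p :: "'x::finite prob_tree"
    and f :: "'x global_var"
    and s :: "'x situation"
  shows "upper_E_meas p f s = upper_E_ax p f s"
proof -
  have "upper_E_ax p = upper_E_meas p"
    unfolding upper_E_ax_def
    by (rule Greatest_equality)
      (auto intro: axioms_le_upper_E_meas P1_upper_E_meas P2_upper_E_meas P3_upper_E_meas
        P4_upper_E_meas P5_upper_E_meas)
  then show ?thesis by simp
qed

end
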